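(* Let $n$ be a positive integer. Among all (weakly connected) digraphs on $n$ vertices without loops or multiple arcs that contain no directed $2$-cycle $\overrightarrow{C_2}$ (i.e. no pair of vertices $u,v$ with both $(u,v)$ and $(v,u)$ arcs), the maximum Laplacian energy equals $$\frac{n(n-1)(2n-1)}{6},$$ and this maximum is attained exactly by the transitive tournament on $n$ vertices.
   Context: For a digraph $G$ on vertices $v_1,\dots,v_n$, $A(G)$ is the adjacency matrix, $D^+(G)$ the diagonal matrix of outdegrees, and $L(G)=D^+(G)-A(G)$ the Laplacian matrix. The Laplacian energy is $LE(G)=\sum_{i=1}^n\lambda_i^2$ where $\lambda_i$ are the eigenvalues of $L(G)$; equivalently $LE(G)=\sum_i (d_i^+)^2+c_2$, with $c_2$ the number of directed closed walks of length $2$. A tournament is an orientation of a complete graph; it is transitive if $(u,v),(v,w)$ arcs imply $(u,w)$ is an arc. *)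

theory Defs
  imports
    "Jordan_Normal_Form.Spectral_Radius"
    "Graph_Theory.Graph_Theory"
begin

text \<open>
  Digraphs without multiple arcs are represented by \<open>'a pair_pre_digraph\<close> (arcs are ordered pairs);
  the locale \<open>pair_digraph\<close> adds finiteness and the absence of loops. Matrices are taken with
  respect to an enumeration \<open>vs\<close> of the vertices without repetitions, \<open>vs ! i\<close> being the vertex
  with row and column index \<open>i\<close>.
\<close>

definition adjacency_matrix :: "'a list \<Rightarrow> 'a pair_pre_digraph \<Rightarrow> complex mat" where
  "adjacency_matrix vs G =
     mat (length vs) (length vs) (\<lambda>(i, j). if vs ! i \<rightarrow>\<^bsub>G\<^esub> vs ! j then 1 else 0)"

definition out_degree_matrix :: "'a list \<Rightarrow> 'a pair_pre_digraph \<Rightarrow> complex mat" where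
  "out_degree_matrix vs G =
     mat (length vs) (length vs) (\<lambda>(i, j). if i = j then of_nat (out_degree G (vs ! i)) else 0)"

definition laplacian_matrix :: "'a list \<Rightarrow> 'a pair_pre_digraph \<Rightarrow> complex mat" where
  "laplacian_matrix vs G = out_degree_matrix vs G - adjacency_matrix vs G"

text \<open>
  The Laplacian matrix need not be symmetric, so its eigenvalues are complex numbers; they are
  counted with algebraic multiplicity.
\<close>

definition laplacian_energy :: "'a list \<Rightarrow> 'a pair_pre_digraph \<Rightarrow> complex" where
  "laplacian_energy vs G =
     (\<Sum>\<mu>\<in>spectrum (laplacian_matrix vs G).
        of_nat (Polynomial.order \<mu> (char_poly (laplacian_matrix vs G))) * \<mu>\<^sup>2)"

definition has_two_cycle :: "'a pair_pre_digraph \<Rightarrow> bool" where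
  "has_two_cycle G \<longleftrightarrow> (\<exists>u v. u \<noteq> v \<and> u \<rightarrow>\<^bsub>G\<^esub> v \<and> v \<rightarrow>\<^bsub>G\<^esub> u)"

text \<open>
  \<open>Digraph_Component.connected\<close> is connectedness of the underlying undirected graph, that is,
  weak connectedness.
\<close>

definition two_cycle_free_digraphs :: "'a set \<Rightarrow> 'a pair_pre_digraph set" where
  "two_cycle_free_digraphs V =
     {G. pair_digraph G \<and> pverts G = V \<and> Digraph_Component.connected G \<and> \<not> has_two_cycle G}"

definition tournament :: "'a pair_pre_digraph \<Rightarrow> bool" where
  "tournament G \<longleftrightarrow> pair_digraph G \<and>
     (\<forall>u\<in>pverts G. \<forall>v\<in>pverts G. u \<noteq> v \<longrightarrow> (u \<rightarrow>\<^bsub>G\<^esub> v) \<noteq> (v \<rightarrow>\<^bsub>G\<^esub> u))"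

definition transitive_tournament :: "'a pair_pre_digraph \<Rightarrow> bool" where
  "transitive_tournament G \<longleftrightarrow> tournament G \<and>
     (\<forall>u v w. u \<rightarrow>\<^bsub>G\<^esub> v \<longrightarrow> v \<rightarrow>\<^bsub>G\<^esub> w \<longrightarrow> u \<rightarrow>\<^bsub>G\<^esub> w)"

end

theory Submission
  imports Defs
begin

text \<open>
  The Laplacian energy is the trace of \<open>L\<^sup>2\<close>, which without directed 2-cycles is the sum of the
  squared out-degrees. Since \<open>d\<^sup>2 = d + d (d - 1)\<close>, this sum counts the arcs together with the
  triples \<open>(u, v, w)\<close> such that \<open>u \<rightarrow> v\<close>, \<open>u \<rightarrow> w\<close> and \<open>v \<noteq> w\<close>. There is at most one arc for
  each pair of vertices, and a set of three vertices contains at most one source, so the energy is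
  at most \<open>n (n - 1) / 2 + n (n - 1) (n - 2) / 3\<close>. Equality means that every pair is joined by an
  arc and every triple has a source, that is, that the digraph is a tournament without cyclic
  triangles.
\<close>

section \<open>Sums over eigenvalues as traces\<close>

text \<open>The order of \<open>a\<close> in a product of linear factors is the number of
  occurrences of \<open>a\<close> in the list. This turns the sum over distinct eigenvalues with
  multiplicities into a sum over a list, which can be compared with the diagonal of a Schur
  form.\<close>

lemma sum_order_prod_list_linear:
  fixes as :: "'a::idom list" and f :: "'a \<Rightarrow> 'b::comm_semiring_1"
  shows "(\<Sum>a\<in>set as. of_nat (Polynomial.order a (\<Prod>b\<leftarrow>as. [:- b, 1:])) * f a) = (\<Sum>a\<leftarrow>as. f a)"
proof -
  have order: "Polynomial.order a (\<Prod>b\<leftarrow>as. [:- b, 1:]) = count_list as a" for a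
  proof (induction as)
    case Nil
    then show ?case by (simp add: order_0I)
  next
    case (Cons b as)
    have "monic (\<Prod>b\<leftarrow>as. [:- b, 1:])"
      by (rule monic_prod_list) auto
    then have nz: "(\<Prod>b\<leftarrow>as. [:- b, 1:]) \<noteq> 0"
      by auto
    have "Polynomial.order a [:- b, 1:] = (if a = b then 1 else 0)"
      using order_linear[of a] by (auto intro!: order_0I)
    moreover have "[:- b, 1:] * (\<Prod>b\<leftarrow>as. [:- b, 1:]) \<noteq> 0"
      using nz by (intro no_zero_divisors) auto
    ultimately show ?case
      using Cons.IH by (simp del: mult_pCons_left add: order_mult)
  qed
  \<comment> \<open>The index set is generalised to a fixed finite \<open>X\<close>, because
    \<open>set as\<close> itself would change during the induction on the list.\<close>
  have "(\<Sum>a\<in>X. of_nat (count_list as a) * f a) = (\<Sum>a\<leftarrow>as. f a)"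
    if "finite X" "set as \<subseteq> X" for X
    using that
  proof (induction as)
    case (Cons b as)
    have "(\<Sum>a\<in>X. of_nat (count_list (b # as) a) * f a) =
        (\<Sum>a\<in>X. (if a = b then f b else 0) + of_nat (count_list as a) * f a)"
      by (rule sum.cong) (auto simp: algebra_simps)
    then show ?case
      using Cons by (simp add: sum.distrib)
  qed simp
  then show ?thesis
    unfolding order by simp
qed

definition mat_trace :: "'a::comm_monoid_add mat \<Rightarrow> 'a" where
  "mat_trace A = (\<Sum>i<dim_row A. A $$ (i, i))"

lemma mat_trace_mult:
  assumes "A \<in> carrier_mat n m" "B \<in> carrier_mat m n"
  shows "mat_trace (A * B) = (\<Sum>i<n. \<Sum>j<m. A $$ (i, j) * B $$ (j, i))"
  using assms by (simp add: mat_trace_def scalar_prod_def atLeast0LessThan)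

lemma mat_trace_mult_commute:
  fixes A B :: "'a::comm_semiring_0 mat"
  assumes "A \<in> carrier_mat n m" "B \<in> carrier_mat m n"
  shows "mat_trace (A * B) = mat_trace (B * A)"
  unfolding mat_trace_mult[OF assms] mat_trace_mult[OF assms(2,1)]
  by (subst sum.swap) (simp add: mult.commute)

text \<open>Writing \<open>A = P * B * Q\<close>, cyclicity of the trace moves \<open>Q\<close> to
  the front, where it cancels \<open>P\<close>.\<close>

lemma mat_trace_similar:
  fixes A B :: "'a::comm_semiring_1 mat"
  assumes "similar_mat_wit A B P Q"
  shows "mat_trace A = mat_trace B"
proof -
  define n where "n = dim_row A"
  note sim = similar_mat_witD[OF n_def assms]
  have "mat_trace A = mat_trace (Q * (P * B))"
    unfolding sim(3) by (rule mat_trace_mult_commute[of _ n n]) (use sim in auto)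
  also have "Q * (P * B) = B"
    using sim by (metis assoc_mult_mat left_mult_one_mat)
  finally show ?thesis .
qed

text \<open>Over the complex numbers a Schur decomposition makes \<open>A\<close> similar to an
  upper triangular \<open>B\<close> with the eigenvalues on its diagonal. The diagonal of
  \<open>B * B\<close> then consists of their squares, and \<open>B * B\<close> is similar to
  \<open>A * A\<close>.\<close>

lemma sum_eigenvalues_squared:
  fixes A :: "complex mat"
  assumes A: "A \<in> carrier_mat n n"
  shows "(\<Sum>\<mu>\<in>spectrum A. of_nat (Polynomial.order \<mu> (char_poly A)) * \<mu>\<^sup>2) = mat_trace (A * A)"
proof -
  obtain as where as: "char_poly A = (\<Prod>a\<leftarrow>as. [:- a, 1:])"
    using char_poly_factorized[OF A] by auto
  obtain B P Q where "schur_decomposition A as = (B, P, Q)"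
    by (cases "schur_decomposition A as")
  then have sim: "similar_mat_wit A B P Q" and ut: "upper_triangular B" and diag: "diag_mat B = as"
    using schur_decomposition[OF A as] by auto
  have B: "B \<in> carrier_mat n n"
    using similar_mat_witD2[OF A sim] by auto
  have "spectrum A = set as"
    unfolding spectrum_def using eigenvalue_root_char_poly[OF A] linear_poly_root
    by (auto simp: as poly_prod_list prod_list_zero_iff)
  then have "(\<Sum>\<mu>\<in>spectrum A. of_nat (Polynomial.order \<mu> (char_poly A)) * \<mu>\<^sup>2) = (\<Sum>a\<leftarrow>as. a\<^sup>2)"
    unfolding as using sum_order_prod_list_linear[of as "\<lambda>a. a\<^sup>2"] by simp
  also have "\<dots> = (\<Sum>i<n. (B $$ (i, i))\<^sup>2)"
    using B by (simp add: diag[symmetric] diag_mat_def comp_def interv_sum_list_conv_sum_set_nat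
        atLeast0LessThan)
  also have "\<dots> = (\<Sum>i<n. \<Sum>j<n. B $$ (i, j) * B $$ (j, i))"
  proof (rule sum.cong[OF refl])
    fix i assume i: "i \<in> {..<n}"
    \<comment> \<open>For \<open>i\<close> and \<open>j\<close> distinct, one of the two entries
      lies below the diagonal and vanishes.\<close>
    have "B $$ (i, j) * B $$ (j, i) = (if j = i then (B $$ (i, i))\<^sup>2 else 0)" if "j < n" for j
      using that i B upper_triangularD[OF ut, of i j] upper_triangularD[OF ut, of j i]
      by (cases i j rule: linorder_cases) (auto simp: power2_eq_square)
    then show "(B $$ (i, i))\<^sup>2 = (\<Sum>j<n. B $$ (i, j) * B $$ (j, i))"
      using i by simp
  qed
  also have "\<dots> = mat_trace (B * B)"
    by (rule mat_trace_mult[OF B B, symmetric])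
  also have "\<dots> = mat_trace (A * A)"
    using mat_trace_similar[OF similar_mat_wit_pow[OF sim, of 2]] A B
    by (simp add: numeral_2_eq_2)
  finally show ?thesis .
qed

section \<open>The Laplacian energy as a sum of squared out-degrees\<close>

lemma out_degree_with_proj: "out_degree (with_proj G) u = card (parcs G `` {u})"
proof -
  have "out_arcs (with_proj G) u = Pair u ` (parcs G `` {u})"
    by (auto simp: out_arcs_def)
  then show ?thesis
    by (simp add: out_degree_def card_image inj_on_def)
qed

text \<open>In the trace of \<open>L * L\<close>, an off-diagonal product
  \<open>L $$ (i, j) * L $$ (j, i)\<close> is nonzero only if both arcs between the two vertices are
  present, so only the squared diagonal entries survive.\<close>

lemma laplacian_energy_two_cycle_free:
  assumes "distinct vs" and G: "pair_digraph G" and no2: "\<not> has_two_cycle G"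
  shows "laplacian_energy vs G = of_nat (\<Sum>u\<in>set vs. (card (parcs G `` {u}))\<^sup>2)"
proof -
  define L where "L = laplacian_matrix vs G"
  define n where "n = length vs"
  have L: "L \<in> carrier_mat n n"
    by (auto simp: L_def laplacian_matrix_def n_def out_degree_matrix_def adjacency_matrix_def)
  have loopfree: "(u, u) \<notin> parcs G" for u
    using pair_loopfree_digraph.pair_no_loops[of G "(u, u)"] G by (auto simp: pair_digraph_def)
  have L_entry: "L $$ (i, j) = (if i = j then of_nat (card (parcs G `` {vs ! i})) else 0)
      - (if (vs ! i, vs ! j) \<in> parcs G then 1 else 0)" if "i < n" "j < n" for i j
    using that by (simp add: L_def laplacian_matrix_def n_def out_degree_matrix_def
        adjacency_matrix_def out_degree_with_proj)
  have "(u, v) \<notin> parcs G \<or> (v, u) \<notin> parcs G" for u v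
    using no2 loopfree by (auto simp: has_two_cycle_def)
  then have "L $$ (i, j) * L $$ (j, i) =
      (if j = i then of_nat ((card (parcs G `` {vs ! i}))\<^sup>2) else 0)" if "i < n" "j < n" for i j
    using that loopfree by (auto simp: L_entry power2_eq_square)
  then have "mat_trace (L * L) = (\<Sum>i<n. of_nat ((card (parcs G `` {vs ! i}))\<^sup>2))"
    by (simp add: mat_trace_mult[OF L L])
  also have "\<dots> = (\<Sum>u\<in>set vs. of_nat ((card (parcs G `` {u}))\<^sup>2))"
    using bij_betw_nth[OF \<open>distinct vs\<close> refl refl] unfolding n_def
    by (rule sum.reindex_bij_betw)
  finally show ?thesis
    unfolding laplacian_energy_def L_def[symmetric] sum_eigenvalues_squared[OF L] by simp
qed

section \<open>Counting arcs and cherries of an asymmetric relation\<close>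

text \<open>The two out-neighbours are ordered, so a vertex of out-degree \<open>d\<close> is the
  source of \<open>d * (d - 1)\<close> cherries.\<close>

definition out_cherries :: "'a rel \<Rightarrow> ('a \<times> 'a \<times> 'a) set" where
  "out_cherries E = {(u, v, w). (u, v) \<in> E \<and> (u, w) \<in> E \<and> v \<noteq> w}"

lemma sum_out_degree_squared:
  assumes "finite V" "E \<subseteq> V \<times> V"
  shows "(\<Sum>u\<in>V. (card (E `` {u}))\<^sup>2) = card E + card (out_cherries E)"
proof -
  have fin: "finite (E `` {u})" for u
    using assms by (meson finite_Image finite_SigmaI finite_subset)
  have "E = (SIGMA u:V. E `` {u})"
    using assms by auto
  then have 1: "card E = (\<Sum>u\<in>V. card (E `` {u}))"
    using assms fin by (metis card_SigmaI)
  have "out_cherries E = (SIGMA u:V. SIGMA v:E `` {u}. E `` {u} - {v})"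
    using assms by (auto simp: out_cherries_def)
  then have 2: "card (out_cherries E) = (\<Sum>u\<in>V. card (E `` {u}) * (card (E `` {u}) - 1))"
    using assms fin by (simp add: card_SigmaI)
  have "k + k * (k - 1) = k\<^sup>2" for k :: nat
    by (cases k) (simp_all add: power2_eq_square)
  then show ?thesis
    unfolding 1 2 sum.distrib[symmetric] by simp
qed

text \<open>\<open>E\<close> and its converse are disjoint sets of equal size among the ordered
  pairs of distinct vertices. They exhaust these pairs exactly when \<open>E\<close> is
  total.\<close>

lemma card_asym_rel:
  assumes V: "finite V" and E: "E \<subseteq> V \<times> V" and asym: "asym E"
  shows "2 * card E \<le> card V * (card V - 1)"
    and "2 * card E = card V * (card V - 1) \<longleftrightarrow> total_on V E"
proof -
  define D where "D = (SIGMA u:V. V - {u})"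
  have cardD: "card D = card V * (card V - 1)" and finD: "finite D"
    using V by (simp_all add: D_def card_SigmaI)
  have sub: "E \<union> E\<inverse> \<subseteq> D"
    using E asym by (auto simp: D_def asym_on_def)
  have "finite E"
    using sub finD finite_subset by blast
  then have card: "card (E \<union> E\<inverse>) = 2 * card E"
    using asym by (subst card_Un_disjoint) (auto simp: asym_on_def)
  show "2 * card E \<le> card V * (card V - 1)"
    using card_mono[OF finD sub] by (simp add: card cardD)
  have "2 * card E = card V * (card V - 1) \<longleftrightarrow> E \<union> E\<inverse> = D"
    using card_subset_eq[OF finD sub] card cardD by auto
  also have "\<dots> \<longleftrightarrow> total_on V E"
    using sub by (auto simp: D_def total_on_def)
  finally show "2 * card E = card V * (card V - 1) \<longleftrightarrow> total_on V E" .
qed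

text \<open>Equality means that every triple of distinct vertices has a source. For a total
  asymmetric relation this excludes cyclic triangles, which amounts to transitivity.\<close>

lemma card_out_cherries:
  assumes V: "finite V" and E: "E \<subseteq> V \<times> V" and asym: "asym E"
  shows "3 * card (out_cherries E) \<le> card V * (card V - 1) * (card V - 2)"
    and "total_on V E \<Longrightarrow>
      3 * card (out_cherries E) = card V * (card V - 1) * (card V - 2) \<longleftrightarrow> trans E"
proof -
  define D where "D = (SIGMA u:V. SIGMA v:V - {u}. V - {u, v})"
  have "card (V - {u, v}) = card V - 2" if "u \<in> V" "v \<in> V - {u}" for u v
    using that V by (subst card_Diff_subset) (auto simp: card_insert_if)
  then have cardD: "card D = card V * (card V - 1) * (card V - 2)" and finD: "finite D"
    using V by (simp_all add: D_def card_SigmaI)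
  define rot where "rot = (\<lambda>(u :: 'a, v :: 'a, w :: 'a). (v, w, u))"
  have inj: "inj_on rot A" for A
    by (auto simp: rot_def inj_on_def)
  define Q where "Q = out_cherries E"
  have irr: "(u, u) \<notin> E" for u
    using asym by (auto simp: asym_on_def)
  \<comment> \<open>An asymmetric relation has at most one source in every triple of vertices, so the three
    rotations of the set of cherries are disjoint.\<close>
  let ?U = "Q \<union> (rot ` Q \<union> rot ` rot ` Q)"
  have sub: "?U \<subseteq> D"
    using E irr by (auto simp: D_def Q_def out_cherries_def rot_def)
  have "finite Q"
    using sub finD finite_subset by blast
  moreover have "Q \<inter> (rot ` Q \<union> rot ` rot ` Q) = {}" "rot ` Q \<inter> rot ` rot ` Q = {}"
    using asym by (auto simp: Q_def out_cherries_def rot_def asym_on_def)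
  ultimately have card: "card ?U = 3 * card Q"
    by (simp add: card_Un_disjoint card_image inj)
  show "3 * card (out_cherries E) \<le> card V * (card V - 1) * (card V - 2)"
    using card_mono[OF finD sub] unfolding card cardD Q_def[symmetric] .
  assume total: "total_on V E"
  \<comment> \<open>The three disjuncts say which of \<open>u\<close>, \<open>v\<close>,
    \<open>w\<close> is the source of the triple.\<close>
  have U_iff: "(u, v, w) \<in> ?U \<longleftrightarrow>
      (u, v) \<in> E \<and> (u, w) \<in> E \<and> v \<noteq> w \<or>
      (v, w) \<in> E \<and> (v, u) \<in> E \<and> w \<noteq> u \<or>
      (w, u) \<in> E \<and> (w, v) \<in> E \<and> u \<noteq> v" for u v w
    by (force simp: Q_def out_cherries_def rot_def image_iff)
  have "3 * card Q = card V * (card V - 1) * (card V - 2) \<longleftrightarrow> ?U = D"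
    using card_subset_eq[OF finD sub] card cardD by auto
  also have "\<dots> \<longleftrightarrow> trans E"
  proof
    assume eq: "?U = D"
    show "trans E"
    proof (rule transI)
      fix u v w assume uv: "(u, v) \<in> E" and vw: "(v, w) \<in> E"
      \<comment> \<open>Neither \<open>v\<close> nor \<open>w\<close> can be the source, so it is
        \<open>u\<close>, which yields the arc from \<open>u\<close> to \<open>w\<close>.\<close>
      have no: "(v, u) \<notin> E" "(w, v) \<notin> E"
        using uv vw asym by (auto simp: asym_on_def)
      then have "(u, v, w) \<in> D"
        using uv vw E irr by (auto simp: D_def)
      then show "(u, w) \<in> E"
        using U_iff[of u v w] no by (simp add: eq)
    qed
  next
    assume trans: "trans E"
    have "(u, v, w) \<in> ?U" if "(u, v, w) \<in> D" for u v w
    proof -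
      \<comment> \<open>Three arcs that do not form a cycle leave some vertex with two of them; if
        they form a cycle, transitivity supplies the second arc.\<close>
      from that have "(u, v) \<in> E \<or> (v, u) \<in> E" "(u, w) \<in> E \<or> (w, u) \<in> E" "(v, w) \<in> E \<or> (w, v) \<in> E"
        and "u \<noteq> v" "v \<noteq> w" "w \<noteq> u"
        using total by (auto simp: D_def total_on_def)
      then show ?thesis
        unfolding U_iff using transD[OF trans] by blast
    qed
    then show "?U = D"
      using sub by (intro equalityI subrelI) auto
  qed
  finally show "3 * card (out_cherries E) = card V * (card V - 1) * (card V - 2) \<longleftrightarrow> trans E"
    by (simp add: Q_def)
qed

text \<open>The factor 6 clears the denominators, and \<open>2 * m - 1 = 3 + 2 * (m - 2)\<close>
  splits the bound into the arc bound and the cherry bound.\<close>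

lemma sum_out_degree_squared_asym:
  assumes V: "finite V" and E: "E \<subseteq> V \<times> V" and asym: "asym E"
  shows "6 * (\<Sum>u\<in>V. (card (E `` {u}))\<^sup>2) \<le> card V * (card V - 1) * (2 * card V - 1)"
    and "6 * (\<Sum>u\<in>V. (card (E `` {u}))\<^sup>2) = card V * (card V - 1) * (2 * card V - 1) \<longleftrightarrow>
      total_on V E \<and> trans E"
proof -
  have bound: "m * (m - 1) * (2 * m - 1) = 3 * (m * (m - 1)) + 2 * (m * (m - 1) * (m - 2))"
    for m :: nat
  \<comment> \<open>Here \<open>m - 2\<close> is truncated, but \<open>m * (m - 1) = 0\<close> makes
    both sides vanish.\<close>
  proof (cases "m < 2")
    case True
    then show ?thesis by (cases m) auto
  next
    case False
    then obtain k where "m = k + 2" by (metis add.commute le_iff_add not_less)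
    then show ?thesis by (simp add: algebra_simps)
  qed
  have sum: "6 * (\<Sum>u\<in>V. (card (E `` {u}))\<^sup>2) = 3 * (2 * card E) + 2 * (3 * card (out_cherries E))"
    by (simp add: sum_out_degree_squared[OF V E])
  note le = card_asym_rel(1)[OF assms] card_out_cherries(1)[OF assms]
  show "6 * (\<Sum>u\<in>V. (card (E `` {u}))\<^sup>2) \<le> card V * (card V - 1) * (2 * card V - 1)"
    unfolding sum bound using le by linarith
  \<comment> \<open>The sum of two upper bounds is attained only if each of them is.\<close>
  have "6 * (\<Sum>u\<in>V. (card (E `` {u}))\<^sup>2) = card V * (card V - 1) * (2 * card V - 1) \<longleftrightarrow>
      2 * card E = card V * (card V - 1) \<and>
      3 * card (out_cherries E) = card V * (card V - 1) * (card V - 2)"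
    unfolding sum bound using le by linarith
  then show "6 * (\<Sum>u\<in>V. (card (E `` {u}))\<^sup>2) = card V * (card V - 1) * (2 * card V - 1) \<longleftrightarrow>
      total_on V E \<and> trans E"
    using card_asym_rel(2)[OF assms] card_out_cherries(2)[OF assms] by blast
qed

section \<open>Digraph notions in terms of the arc relation\<close>

lemma asym_parcs_iff:
  assumes "pair_digraph G"
  shows "asym (parcs G) \<longleftrightarrow> \<not> has_two_cycle G"
proof -
  have "(u, u) \<notin> parcs G" for u
    using pair_loopfree_digraph.pair_no_loops[of G "(u, u)"] assms by (auto simp: pair_digraph_def)
  then show ?thesis
    unfolding has_two_cycle_def asym_on_def by auto
qed

lemma parcs_subset:
  assumes "pair_digraph G"
  shows "parcs G \<subseteq> pverts G \<times> pverts G"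
proof -
  interpret pair_digraph G by fact
  show ?thesis using in_arcsD1 in_arcsD2 by auto
qed

text \<open>Exactly one arc per pair splits into at most one (asymmetry) and at least one
  (totality), the two conditions that the counting lemmas use.\<close>

lemma transitive_tournament_iff:
  "transitive_tournament G \<longleftrightarrow>
     pair_digraph G \<and> asym (parcs G) \<and> total_on (pverts G) (parcs G) \<and> trans (parcs G)"
proof (cases "pair_digraph G")
  case True
  then interpret pair_digraph G .
  have "tournament G \<longleftrightarrow> asym (parcs G) \<and> total_on (pverts G) (parcs G)"
    using no_loops' in_arcsD1 in_arcsD2 True
    unfolding tournament_def asym_on_def total_on_def with_proj_simps by blast
  then show ?thesis
    using True by (auto simp: transitive_tournament_def trans_def)
qed (simp add: transitive_tournament_def tournament_def)

text \<open>Any two distinct vertices are adjacent in the symmetric closure, so one step suffices.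
  This places transitive tournaments among the weakly connected digraphs.\<close>

lemma connected_if_total:
  assumes "pverts G \<noteq> {}" "total_on (pverts G) (parcs G)"
  shows "Digraph_Component.connected (with_proj G)"
  unfolding connected_def
proof (rule strongly_connectedI)
  fix u v assume "u \<in> verts (with_proj (mk_symmetric (with_proj G)))"
    "v \<in> verts (with_proj (mk_symmetric (with_proj G)))"
  then have u: "u \<in> pverts G" and v: "v \<in> pverts G"
    by simp_all
  show "u \<rightarrow>\<^sup>*\<^bsub>with_proj (mk_symmetric (with_proj G))\<^esub> v"
  proof (cases "u = v")
    case False
    with u v assms have "(u, v) \<in> parcs (mk_symmetric (with_proj G))"
      by (force simp: parcs_mk_symmetric total_on_def)
    then show ?thesis
      using u v by (auto simp: reachable_def intro: rtrancl_on_into_rtrancl_on)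
  qed (use u in \<open>simp add: reachable_def\<close>)
qed (use assms in simp)

section \<open>Uniqueness of the transitive tournament up to isomorphism\<close>

text \<open>The out-degrees of a transitive tournament strictly decrease along arcs, hence they are
  \<open>0, \<dots>, n - 1\<close> and determine the arcs.\<close>

lemma
  assumes V: "finite V" and E: "E \<subseteq> V \<times> V" and asym: "asym E" and total: "total_on V E"
    and trans: "trans E"
  shows bij_betw_out_degree: "bij_betw (\<lambda>u. card (E `` {u})) V {..<card V}"
    and arc_iff_out_degree_less:
      "\<lbrakk>u \<in> V; v \<in> V\<rbrakk> \<Longrightarrow> (u, v) \<in> E \<longleftrightarrow> card (E `` {v}) < card (E `` {u})"
proof -
  have sub: "E `` {u} \<subseteq> V - {u}" for u
    using E asym by (auto simp: asym_on_def)
  have mono: "card (E `` {v}) < card (E `` {u})" if "(u, v) \<in> E" for u v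
  proof (rule psubset_card_mono)
    show "finite (E `` {u})"
      using sub V by (meson finite_Diff finite_subset)
    \<comment> \<open>Transitivity gives the inclusion; it is strict because \<open>v\<close>
      belongs only to the larger set.\<close>
    show "E `` {v} \<subset> E `` {u}"
      using that transD[OF trans] sub[of v] by blast
  qed
  have inj: "inj_on (\<lambda>u. card (E `` {u})) V"
    using total mono unfolding total_on_def inj_on_def by (metis less_irrefl)
  have "card (E `` {u}) < card V" if "u \<in> V" for u
    using card_mono[OF _ sub[of u]] V that by (metis card_Diff1_less finite_Diff le_less_trans)
  \<comment> \<open>An injection of \<open>V\<close> into a set of \<open>card V\<close> elements is
    onto.\<close>
  then show "bij_betw (\<lambda>u. card (E `` {u})) V {..<card V}"
    using inj by (intro bij_betw_imageI card_subset_eq) (auto simp: card_image)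
  show "(u, v) \<in> E \<longleftrightarrow> card (E `` {v}) < card (E `` {u})" if "u \<in> V" "v \<in> V"
    using that total mono unfolding total_on_def by (metis less_asym less_irrefl)
qed

text \<open>Arcs are ordered pairs, so the vertex map \<open>f\<close> induces the arc map
  \<open>map_prod f f\<close>. Surjectivity on arcs uses that the ends of every arc of
  \<open>T\<close> lie in the image of \<open>f\<close>.\<close>

lemma digraph_isoI:
  assumes S: "pair_digraph S" and f: "bij_betw f (pverts S) (pverts T)"
    and T: "parcs T \<subseteq> pverts T \<times> pverts T"
    and arcs: "\<And>u v. u \<in> pverts S \<Longrightarrow> v \<in> pverts S \<Longrightarrow> (u, v) \<in> parcs S \<longleftrightarrow> (f u, f v) \<in> parcs T"
  shows "digraph_iso (with_proj S) (with_proj T)"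
proof -
  interpret S: pair_digraph S by fact
  define h where "h = \<lparr>iso_verts = f, iso_arcs = map_prod f f, iso_head = snd, iso_tail = fst\<rparr>"
  have inj: "inj_on f (pverts S)"
    using f by (simp add: bij_betw_def)
  have "inj_on (map_prod f f) (pverts S \<times> pverts S)"
    using inj inj by (rule map_prod_inj_on)
  then have "inj_on (map_prod f f) (parcs S)"
    by (rule inj_on_subset) (rule parcs_subset[OF S])
  then have "pre_digraph.digraph_isomorphism (with_proj S) h"
    using inj by (simp add: pre_digraph.digraph_isomorphism_def h_def S.wf_digraph)
  moreover have "parcs T = map_prod f f ` parcs S"
  proof (intro equalityI subsetI)
    fix e assume e: "e \<in> parcs T"
    then obtain u v where "u \<in> pverts S" "v \<in> pverts S" "e = (f u, f v)"
      using T unfolding bij_betw_imp_surj_on[OF f, symmetric] by auto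
    then show "e \<in> map_prod f f ` parcs S"
      using e arcs by force
  next
    fix e assume "e \<in> map_prod f f ` parcs S"
    then show "e \<in> parcs T"
      using arcs parcs_subset[OF S] by auto
  qed
  then have "with_proj T = app_iso h (with_proj S)"
    using f by (simp add: app_iso_def h_def with_proj_def bij_betw_def)
  ultimately show ?thesis
    by (auto simp: digraph_iso_def)
qed

lemma transitive_tournament_arc_iff:
  assumes "transitive_tournament G" "u \<in> pverts G" "v \<in> pverts G"
  shows "(u, v) \<in> parcs G \<longleftrightarrow> card (parcs G `` {v}) < card (parcs G `` {u})"
  using assms parcs_subset[of G] unfolding transitive_tournament_iff
  by (intro arc_iff_out_degree_less[of "pverts G"])
    (auto simp: pair_digraph_def pair_fin_digraph.pair_finite_verts)

text \<open>The isomorphism sends each vertex of \<open>S\<close> to the unique vertex of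
  \<open>T\<close> with the same out-degree; comparing out-degrees decides the arcs on both
  sides.\<close>

lemma transitive_tournament_iso:
  fixes S :: "'a pair_pre_digraph" and T :: "'b pair_pre_digraph"
  assumes "transitive_tournament S" "transitive_tournament T" "card (pverts S) = card (pverts T)"
  shows "digraph_iso (with_proj S) (with_proj T)"
proof -
  have S: "pair_digraph S" and T: "pair_digraph T"
    using assms by (simp_all add: transitive_tournament_iff)
  have fin: "finite (pverts S)" "finite (pverts T)"
    using S T by (simp_all add: pair_digraph_def pair_fin_digraph.pair_finite_verts)
  let ?dS = "\<lambda>u. card (parcs S `` {u})" and ?dT = "\<lambda>u. card (parcs T `` {u})"
  have bij: "bij_betw ?dS (pverts S) {..<card (pverts S)}" "bij_betw ?dT (pverts T) {..<card (pverts S)}"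
    using assms fin bij_betw_out_degree parcs_subset[OF S] parcs_subset[OF T]
    unfolding transitive_tournament_iff by metis+
  define f where "f = inv_into (pverts T) ?dT \<circ> ?dS"
  have f: "bij_betw f (pverts S) (pverts T)"
    unfolding f_def using bij(1) bij_betw_inv_into[OF bij(2)] by (rule bij_betw_trans)
  have dT: "?dT (f u) = ?dS u" if "u \<in> pverts S" for u
    using bij_betw_inv_into_right[OF bij(2)] bij_betwE[OF bij(1)] that by (simp add: f_def)
  show ?thesis
  proof (rule digraph_isoI[OF S f parcs_subset[OF T]])
    fix u v assume uv: "u \<in> pverts S" "v \<in> pverts S"
    then have "f u \<in> pverts T" "f v \<in> pverts T"
      using bij_betwE[OF f] by auto
    then show "(u, v) \<in> parcs S \<longleftrightarrow> (f u, f v) \<in> parcs T"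
      using uv assms fin by (simp add: transitive_tournament_arc_iff dT)
  qed
qed

section \<open>The extremal value, its attainment and the extremal digraphs\<close>

theorem theorem1p5:
  fixes n :: nat and vs :: "'a list" and M :: real
  assumes "n \<ge> 1" and "distinct vs" and "length vs = n"
    and "M = real n * (real n - 1) * (2 * real n - 1) / 6"
  shows "(\<forall>G\<in>two_cycle_free_digraphs (set vs).
            laplacian_energy vs G \<in> \<real> \<and> Re (laplacian_energy vs G) \<le> M) \<and>
         (\<exists>G\<in>two_cycle_free_digraphs (set vs). laplacian_energy vs G = complex_of_real M) \<and>
         {G \<in> two_cycle_free_digraphs (set vs). laplacian_energy vs G = complex_of_real M} =
           {T. transitive_tournament T \<and> pverts T = set vs} \<and>
         (\<forall>S T. transitive_tournament S \<and> pverts S = set vs \<and>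
                transitive_tournament T \<and> pverts T = set vs \<longrightarrow>
                digraph_iso (with_proj S) (with_proj T))"
proof -
  define s where "s G = (\<Sum>u\<in>set vs. (card (parcs G `` {u}))\<^sup>2)" for G :: "'a pair_pre_digraph"
  have cardV: "card (set vs) = n"
    using assms distinct_card by blast
  \<comment> \<open>Since \<open>n\<close> is at least 1, the natural subtractions
    \<open>n - 1\<close> and \<open>2 * n - 1\<close> agree with the real ones.\<close>
  have M: "6 * M = real (n * (n - 1) * (2 * n - 1))"
    using assms by (simp add: of_nat_diff)
  have member_iff: "G \<in> two_cycle_free_digraphs (set vs) \<longleftrightarrow>
      pair_digraph G \<and> pverts G = set vs \<and> Digraph_Component.connected G \<and> asym (parcs G)" for G
    using asym_parcs_iff[of G] by (auto simp: two_cycle_free_digraphs_def)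
  have energy: "laplacian_energy vs G = complex_of_real (real (s G))" "real (s G) \<le> M"
      "laplacian_energy vs G = complex_of_real M \<longleftrightarrow> transitive_tournament G"
    if "pair_digraph G" "pverts G = set vs" "asym (parcs G)" for G
  proof -
    have E: "parcs G \<subseteq> set vs \<times> set vs"
      using parcs_subset that by blast
    show energy: "laplacian_energy vs G = complex_of_real (real (s G))"
      using laplacian_energy_two_cycle_free[OF \<open>distinct vs\<close>] that
      by (simp add: asym_parcs_iff s_def)
    have "real (s G) \<le> M \<longleftrightarrow> 6 * s G \<le> n * (n - 1) * (2 * n - 1)"
      using of_nat_le_iff[where ?'a = real, of "6 * s G" "n * (n - 1) * (2 * n - 1)"]
      unfolding M[symmetric] by simp
    then show "real (s G) \<le> M"
      using sum_out_degree_squared_asym(1)[OF _ E] that by (simp add: s_def cardV)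
    have "laplacian_energy vs G = complex_of_real M \<longleftrightarrow> real (s G) = M"
      unfolding energy of_real_eq_iff ..
    also have "\<dots> \<longleftrightarrow> 6 * s G = n * (n - 1) * (2 * n - 1)"
      using of_nat_eq_iff[where ?'a = real, of "6 * s G" "n * (n - 1) * (2 * n - 1)"]
      unfolding M[symmetric] by simp
    also have "\<dots> \<longleftrightarrow> total_on (set vs) (parcs G) \<and> trans (parcs G)"
      using sum_out_degree_squared_asym(2)[OF _ E] that by (simp add: s_def cardV)
    finally show "laplacian_energy vs G = complex_of_real M \<longleftrightarrow> transitive_tournament G"
      using that by (simp add: transitive_tournament_iff)
  qed
  have "set vs \<noteq> {}"
    using assms by auto
  have eq: "{G \<in> two_cycle_free_digraphs (set vs). laplacian_energy vs G = complex_of_real M} =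
      {T. transitive_tournament T \<and> pverts T = set vs}"
  proof (intro equalityI subsetI; unfold mem_Collect_eq)
    fix G assume "G \<in> two_cycle_free_digraphs (set vs) \<and> laplacian_energy vs G = complex_of_real M"
    then show "transitive_tournament G \<and> pverts G = set vs"
      using energy(3)[of G] by (simp add: member_iff)
  next
    fix G assume tt: "transitive_tournament G \<and> pverts G = set vs"
    then have "Digraph_Component.connected G"
      using \<open>set vs \<noteq> {}\<close> by (intro connected_if_total) (auto simp: transitive_tournament_iff)
    then show "G \<in> two_cycle_free_digraphs (set vs) \<and> laplacian_energy vs G = complex_of_real M"
      using energy(3)[of G] tt by (auto simp: member_iff transitive_tournament_iff)
  qed
  have ex: "\<exists>G\<in>two_cycle_free_digraphs (set vs). laplacian_energy vs G = complex_of_real M"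
  proof -
    \<comment> \<open>The vertex type carries no order, so an injection into the naturals supplies a
      strict linear order on the vertices, which serves as the arc relation of the witness.\<close>
    obtain r :: "'a \<Rightarrow> nat" where r: "inj_on r (set vs)"
      using finite_imp_inj_to_nat_seg[of "set vs"] by auto
    define T where "T = \<lparr>pverts = set vs, parcs = {(u, v). u \<in> set vs \<and> v \<in> set vs \<and> r u < r v}\<rparr>"
    have "parcs T \<subseteq> set vs \<times> set vs"
      by (auto simp: T_def)
    moreover from this have "finite (parcs T)"
      by (rule finite_subset) simp
    moreover have "asym (parcs T)" "trans (parcs T)"
      by (auto simp: T_def asym_on_def trans_def)
    moreover have "total_on (set vs) (parcs T)"
      using r by (auto simp: T_def total_on_def inj_on_def) (metis linorder_neqE_nat)
    moreover from calculation have "pair_digraph T"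
      by unfold_locales (auto simp: T_def)
    ultimately have "transitive_tournament T"
      by (simp add: transitive_tournament_iff T_def)
    moreover have "pverts T = set vs"
      by (simp add: T_def)
    ultimately have "T \<in> {T. transitive_tournament T \<and> pverts T = set vs}"
      by simp
    then show ?thesis
      unfolding eq[symmetric] by auto
  qed
  have bound: "laplacian_energy vs G \<in> \<real> \<and> Re (laplacian_energy vs G) \<le> M"
    if "G \<in> two_cycle_free_digraphs (set vs)" for G
    using energy(1,2)[of G] that by (simp add: member_iff)
  show ?thesis
  proof (intro conjI ballI allI impI)
    fix S T :: "'a pair_pre_digraph"
    assume "transitive_tournament S \<and> pverts S = set vs \<and>
      transitive_tournament T \<and> pverts T = set vs"
    then show "digraph_iso (with_proj S) (with_proj T)"
      by (intro transitive_tournament_iso) simp_all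
  qed (use bound ex eq in auto)
qed

end
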